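(* Let $\mathbf{f} = f_0f_1f_2\cdots$ be any paperfolding word over the alphabet $\{1,4\}$, and define the infinite word $\mathbf{v} = v_0v_1v_2\cdots$ over $\{1,2,3,4\}$ by $v_{4n} = 2$, $v_{4n+2} = 3$, and $v_{2n+1} = f_{2n+1}$ for all $n \geq 0$. Then no arithmetic subsequence of odd difference of $\mathbf{v}$ contains a square, but for every positive real number $r < 2$ the word $\mathbf{v}$ contains an $r$-power.
   Context: Infinite words $\mathbf{w} = w_0w_1w_2\cdots$ are indexed from $0$. A subword is a contiguous block $w_iw_{i+1}\cdots w_{i+j}$, $i,j\ge 0$. An arithmetic subsequence of difference $j$ of $\mathbf{w}$ is a word $w_iw_{i+j}w_{i+2j}\cdots$ with $i \geq 0$, $j \geq 1$. Paperfolding words over a two-letter alphabet $\{\alpha,\beta\}$: write $\overline{\alpha}=\beta$, $\overline{\beta}=\alpha$. An infinite word $\mathbf{f} = f_0f_1f_2\cdots$ over $\{\alpha,\beta\}$ is a paperfolding word if there exists $a \in \{\alpha,\beta\}$ such that $f_{4n} = a$ and $f_{4n+2} = \overline{a}$ for all $n \geq 0$, and $(f_{2n+1})_{n\geq 0}$ is again a paperfolding word. (This recursive definition is to be unfolded indefinitely: putting $\mathbf{f}^{(0)}=\mathbf{f}$ and $f^{(k+1)}_n = f^{(k)}_{2n+1}$, for every $k\ge 0$ there is a letter $a_k$ with $f^{(k)}_{4n}=a_k$ and $f^{(k)}_{4n+2}=\overline{a_k}$ for all $n\ge 0$.) A square is a word $xx$ with $x$ non-empty. For a positive rational $q$, a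 $q$-power is a non-empty word $x^kx'$, where $k\ge 0$ is an integer, $x'$ is a prefix of $x$ and $|x^kx'|/|x| = q$. A word contains an $r$-power ($r>0$ real) if it contains a $q$-power as a subword for some rational $q \geq r$. *)

theory Defs
  imports Complex_Main "HOL-Library.Sublist" "HOL-Library.Omega_Words_Fun"
begin

definition subword :: "'a list \<Rightarrow> 'a word \<Rightarrow> bool" where
  "subword u w \<longleftrightarrow> (\<exists>i j. u = w[i \<rightarrow> i + j + 1])"

definition arith_subseq :: "'a word \<Rightarrow> nat \<Rightarrow> nat \<Rightarrow> 'a word" where
  "arith_subseq w i j = (\<lambda>n. w (i + n * j))"

definition is_square :: "'a list \<Rightarrow> bool" where
  "is_square z \<longleftrightarrow> (\<exists>x. x \<noteq> [] \<and> z = x @ x)"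

definition contains_square :: "'a word \<Rightarrow> bool" where
  "contains_square w \<longleftrightarrow> (\<exists>z. subword z w \<and> is_square z)"

definition is_power :: "rat \<Rightarrow> 'a list \<Rightarrow> bool" where
  "is_power q z \<longleftrightarrow> z \<noteq> [] \<and>
     (\<exists>x k x'. x \<noteq> [] \<and> Sublist.prefix x' x \<and> z = concat (replicate k x) @ x' \<and>
        of_nat (length z) / of_nat (length x) = q)"

definition contains_power :: "real \<Rightarrow> 'a word \<Rightarrow> bool" where
  "contains_power r w \<longleftrightarrow> (\<exists>q. r \<le> of_rat q \<and> (\<exists>z. subword z w \<and> is_power q z))"

text \<open>The letter exchange on a two-letter alphabet; only used on the two letters themselves.\<close>

definition swap_letter :: "'a \<Rightarrow> 'a \<Rightarrow> 'a \<Rightarrow> 'a" where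
  "swap_letter \<alpha> \<beta> a = (if a = \<alpha> then \<beta> else \<alpha>)"

definition odd_part :: "'a word \<Rightarrow> 'a word" where
  "odd_part w = (\<lambda>n. w (2 * n + 1))"

text \<open>The recursive definition of paperfolding words, unfolded indefinitely: the \<open>k\<close>-th iterate
  of \<^const>\<open>odd_part\<close> satisfies the condition on even positions for some letter depending on \<open>k\<close>.\<close>

definition paperfolding :: "'a \<Rightarrow> 'a \<Rightarrow> 'a word \<Rightarrow> bool" where
  "paperfolding \<alpha> \<beta> f \<longleftrightarrow> \<alpha> \<noteq> \<beta> \<and> range f \<subseteq> {\<alpha>, \<beta>} \<and>
     (\<forall>k. \<exists>a\<in>{\<alpha>, \<beta>}. \<forall>n. (odd_part ^^ k) f (4 * n) = a \<and>
        (odd_part ^^ k) f (4 * n + 2) = swap_letter \<alpha> \<beta> a)"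

end

theory Submission
  imports Defs "HOL-Number_Theory.Cong"
begin

text \<open>
  Counting positions from 1, every position is \<open>p = 2 ^ k * m\<close> with \<open>m\<close> odd. In a paperfolding
  word the letter at \<open>p\<close> depends only on the scale \<open>k\<close> and on \<open>m\<close> modulo 4, and for fixed \<open>k\<close> the
  two residues of \<open>m\<close> give different letters. The word \<open>v\<close> inherits this from \<open>f\<close> on the scales
  \<open>k > 0\<close> and has it on scale 0 with the two letters 2 and 3, which occur on no other scale.

  \<^emph>\<open>No squares.\<close> A square of period \<open>L = 2 ^ e * l\<close>, \<open>l\<close> odd, in a subsequence of odd difference \<open>j\<close>
  compares positions that differ by \<open>L * j\<close>. If \<open>e = 0\<close>, it compares an even with an odd position,
  which carry letters from disjoint sets. If \<open>e > 0\<close>, then, \<open>j\<close> being odd, the positions in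
  the first half of the square meet every residue class modulo \<open>2 ^ e\<close>, in particular
  that of \<open>2 ^ (e - 1)\<close>. Such a position is \<open>2 ^ (e - 1) * m\<close> with \<open>m\<close> odd, and
  adding \<open>L * j\<close> turns \<open>m\<close> into \<open>m + 2 * (l * j)\<close>, the other odd residue modulo 4; so the letters
  differ (\<open>square_free_arith_subseq\<close>).

  \<^emph>\<open>Powers close to 2.\<close> Adding \<open>2 ^ e\<close> preserves the letter at all positions on scales
  below \<open>e - 1\<close>, and thus at all positions strictly between \<open>2 ^ e * c - 2 ^ (e - 1)\<close> and
  \<open>2 ^ e * c + 2 ^ (e - 1)\<close> except possibly the centre \<open>2 ^ e * c\<close>. The letters at \<open>2 ^ e\<close> and
  \<open>3 * 2 ^ e\<close> exhaust the two-letter alphabet, so the letter at \<open>2 * 2 ^ e\<close> equals one of them, and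
  \<open>c = 1\<close> or \<open>c = 2\<close> makes the centre agree as well. This gives period \<open>2 ^ e\<close> on a block of length
  \<open>2 * 2 ^ e - 1\<close>, a power of exponent \<open>2 - 1 / 2 ^ e\<close>
  (\<open>shift_invariant_block\<close>, \<open>contains_powerI_period\<close>).
\<close>

section \<open>Words alternating at every dyadic scale\<close>

text \<open>The subtraction of 1 converts positions counted from 1 into indices.\<close>

definition dyadically_alternating :: "'a word \<Rightarrow> bool" where
  "dyadically_alternating w \<longleftrightarrow> (\<forall>k. \<exists>a b. a \<noteq> b \<and>
     (\<forall>n. w (2 ^ k * (4 * n + 1) - 1) = a \<and> w (2 ^ k * (4 * n + 3) - 1) = b))"

lemma odd_nat_cases_mod_4:
  fixes m :: nat
  assumes "odd m"
  obtains n where "m = 4 * n + 1" | n where "m = 4 * n + 3"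
proof -
  have "m mod 4 = 1 \<or> m mod 4 = 3" using assms by presburger
  moreover have "m = 4 * (m div 4) + m mod 4" by simp
  ultimately show thesis using that by metis
qed

lemma dyadically_alternating_eq:
  assumes "dyadically_alternating w" "odd m"
  shows "w (2 ^ k * (m + 4 * l) - 1) = w (2 ^ k * m - 1)"
proof -
  obtain a b where ab: "\<And>n. w (2 ^ k * (4 * n + 1) - 1) = a" "\<And>n. w (2 ^ k * (4 * n + 3) - 1) = b"
    using assms(1) unfolding dyadically_alternating_def by metis
  show ?thesis using assms(2)
  proof (cases rule: odd_nat_cases_mod_4)
    case (1 n)
    then have "m + 4 * l = 4 * (n + l) + 1" by simp
    then show ?thesis using 1 ab(1) by metis
  next
    case (2 n)
    then have "m + 4 * l = 4 * (n + l) + 3" by simp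
    then show ?thesis using 2 ab(2) by metis
  qed
qed

lemma dyadically_alternating_neq:
  assumes "dyadically_alternating w" "odd m" "odd l"
  shows "w (2 ^ k * (m + 2 * l) - 1) \<noteq> w (2 ^ k * m - 1)"
proof -
  obtain a b where ab: "a \<noteq> b" "\<And>n. w (2 ^ k * (4 * n + 1) - 1) = a"
      "\<And>n. w (2 ^ k * (4 * n + 3) - 1) = b"
    using assms(1) unfolding dyadically_alternating_def by metis
  obtain h where h: "l = 2 * h + 1" using assms(3) by (rule oddE)
  show ?thesis using assms(2)
  proof (cases rule: odd_nat_cases_mod_4)
    case (1 n)
    then have "m + 2 * l = 4 * (n + h) + 3" using h by simp
    then show ?thesis using 1 ab by metis
  next
    case (2 n)
    then have "m + 2 * l = 4 * (n + h + 1) + 1" using h by simp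
    then show ?thesis using 2 ab by metis
  qed
qed

lemma two_power_times_odd:
  fixes n :: nat
  assumes "n > 0"
  obtains k m where "n = 2 ^ k * m" "odd m"
proof -
  have "n \<noteq> 0" "\<not> is_unit (2 :: nat)" using assms by auto
  then obtain m where "n = 2 ^ multiplicity 2 n * m" "\<not> 2 dvd m"
    by (rule multiplicity_decompose')
  then show thesis using that by blast
qed

section \<open>Squares\<close>

lemma contains_squareE:
  assumes "contains_square w"
  obtains s L where "L > 0" "\<And>t. t < L \<Longrightarrow> w (s + t) = w (s + t + L)"
proof -
  obtain x s j where x: "x \<noteq> []" and eq: "x @ x = map w [s..<s + j + 1]"
    using assms unfolding contains_square_def subword_def is_square_def subsequence_def by metis
  have len: "length x + length x = j + 1"
    using arg_cong[OF eq, of length] by simp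
  have "w (s + t) = w (s + t + length x)" if t: "t < length x" for t
  proof -
    have "(x @ x) ! t = (x @ x) ! (t + length x)"
      using t by (simp add: nth_append)
    then show ?thesis
      unfolding eq using t len by (simp add: add.assoc del: upt_Suc)
  qed
  then show thesis using that[of "length x" s] x by simp
qed

text \<open>An odd difference is invertible modulo every power of 2.\<close>

lemma odd_progression_hits_residue:
  fixes p j :: nat
  assumes "odd j"
  obtains t where "t < 2 ^ e" "[p + t * j = r] (mod 2 ^ e)"
proof -
  have "coprime j (2 ^ e)" using assms by simp
  then obtain x where x: "[j * x = 1] (mod 2 ^ e)"
    using cong_solve_coprime_nat[of j "2 ^ e"] by auto
  \<comment> \<open>Modulo \<open>2 ^ e\<close>, the number \<open>c\<close> is \<open>r - p\<close>.\<close>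
  define c where "c = r + p * (2 ^ e - 1)"
  define t where "t = (x * c) mod 2 ^ e"
  have "[t * j = x * c * j] (mod 2 ^ e)"
    unfolding t_def by (intro cong_mult cong_refl) simp
  also have "x * c * j = (j * x) * c" by (simp add: algebra_simps)
  also have "[(j * x) * c = 1 * c] (mod 2 ^ e)"
    using x by (intro cong_mult cong_refl)
  finally have "[p + t * j = p + c] (mod 2 ^ e)"
    by (intro cong_add cong_refl) simp
  also have "p + c = r + p * Suc (2 ^ e - 1)"
    unfolding c_def by (simp only: mult_Suc_right add_ac)
  also have "Suc (2 ^ e - 1) = (2 ^ e :: nat)" by simp
  also have "[r + p * 2 ^ e = r] (mod 2 ^ e)"
    by (simp add: cong_def)
  finally have "[p + t * j = r] (mod 2 ^ e)" .
  moreover have "t < 2 ^ e" unfolding t_def by simp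
  ultimately show thesis using that by blast
qed

text \<open>
  For odd \<open>l\<close> and \<open>j\<close> the shift \<open>2 ^ Suc k * l * j\<close> moves a position on scale \<open>k\<close> to one with
  the opposite letter of that scale, and any \<open>2 ^ Suc k\<close> consecutive members of the
  progression contain a position on scale \<open>k\<close>. Odd periods escape this argument; the
  assumption on parities excludes them.
\<close>

lemma square_free_arith_subseq:
  assumes alt: "dyadically_alternating w"
    and parity: "\<And>m n. even m \<Longrightarrow> odd n \<Longrightarrow> w m \<noteq> w n"
    and j: "odd j"
  shows "\<not> contains_square (arith_subseq w i j)"
proof
  assume "contains_square (arith_subseq w i j)"
  then obtain s L where L: "L > 0"
    and sq: "\<And>t. t < L \<Longrightarrow> arith_subseq w i j (s + t) = arith_subseq w i j (s + t + L)"
    by (rule contains_squareE) blast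
  define p where "p = i + s * j + 1"
  have sq': "w (p + t * j - 1) = w (p + t * j + L * j - 1)" if "t < L" for t
    using sq[OF that] by (simp add: arith_subseq_def p_def algebra_simps)
  obtain e l where el: "L = 2 ^ e * l" "odd l" using L by (rule two_power_times_odd)
  show False
  proof (cases e)
    case 0
    then have "odd (L * j)" using el j by simp
    then have "odd (p - 1 + (p + L * j - 1))" unfolding p_def by simp
    then have "w (p - 1) \<noteq> w (p + L * j - 1)"
      using parity by (metis odd_add)
    then show False using sq'[of 0] L by simp
  next
    case (Suc k)
    obtain t where t: "t < 2 ^ e" "[p + t * j = 2 ^ k] (mod 2 ^ e)"
      using j by (rule odd_progression_hits_residue)
    have "(p + t * j) mod 2 ^ e = 2 ^ k"
      using t(2) Suc by (simp add: cong_def)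
    then have "p + t * j = 2 ^ e * ((p + t * j) div 2 ^ e) + 2 ^ k"
      by (metis mult_div_mod_eq)
    then have "p + t * j = 2 ^ k * (2 * ((p + t * j) div 2 ^ e) + 1)"
      using Suc by (simp add: algebra_simps)
    then obtain q where q: "p + t * j = 2 ^ k * (2 * q + 1)" by blast
    then have "p + t * j + L * j = 2 ^ k * ((2 * q + 1) + 2 * (l * j))"
      using el Suc by (simp add: algebra_simps)
    then have "w (p + t * j + L * j - 1) \<noteq> w (p + t * j - 1)"
      using dyadically_alternating_neq[OF alt, of "2 * q + 1" "l * j" k] el(2) j
      by (simp only: q) simp
    moreover have "2 ^ e \<le> L" using el by (cases l) auto
    ultimately show False using sq'[of t] t(1) by simp
  qed
qed

section \<open>Powers of exponent close to 2\<close>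

text \<open>
  A position on scale at least \<open>e\<close> is a multiple of \<open>2 ^ e\<close>, and the centre is the only one in
  this range. On smaller scales \<open>2 ^ Suc e\<close> changes the odd part by a multiple of 4.
\<close>

lemma shift_invariant_block:
  assumes alt: "dyadically_alternating w"
    and centre: "w (2 ^ Suc e * c - 1) = w (2 ^ Suc e * (c + 1) - 1)"
    and p: "2 ^ Suc e * c < p + 2 ^ e" "p < 2 ^ Suc e * c + 2 ^ e" and "p > 0"
  shows "w (p + 2 ^ Suc e - 1) = w (p - 1)"
proof -
  obtain k m where km: "p = 2 ^ k * m" "odd m" using \<open>p > 0\<close> by (rule two_power_times_odd)
  show ?thesis
  proof (cases "k < e")
    case True
    then obtain d where "e = k + Suc d" using less_imp_Suc_add by fastforce
    then have "p + 2 ^ Suc e = 2 ^ k * (m + 4 * 2 ^ d)"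
      using km by (simp add: algebra_simps power_add)
    then show ?thesis using dyadically_alternating_eq[OF alt km(2), of k "2 ^ d"] km(1) by simp
  next
    case False
    then have "2 ^ e dvd p" using km by (simp add: le_imp_power_dvd)
    then obtain q where q: "p = 2 ^ e * q" by (rule dvdE)
    have "2 ^ e * (2 * c) < 2 ^ e * (q + 1)" "2 ^ e * q < 2 ^ e * (2 * c + 1)"
      using p q by (simp_all add: algebra_simps)
    then have "2 * c < q + 1" "q < 2 * c + 1"
      by (simp_all only: nat_mult_less_cancel1 zero_less_power zero_less_numeral)
    then have "q = 2 * c" by linarith
    then have "p = 2 ^ Suc e * c" "p + 2 ^ Suc e = 2 ^ Suc e * (c + 1)" using q by simp_all
    then show ?thesis using centre by metis
  qed
qed

lemma contains_powerI_period:
  fixes w :: "'a word" and d n s :: nat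
  assumes "d > 0" "n > 0" "n \<le> d"
    and period: "\<And>t. t < n \<Longrightarrow> w (s + t + d) = w (s + t)"
    and r: "r \<le> real (d + n) / real d"
  shows "contains_power r w"
proof -
  define x where "x = map w [s..<s + d]"
  define y where "y = map w [s..<s + n]"
  define z where "z = map w [s..<s + (d + n - 1) + 1]"
  have "z = map w [s..<s + d] @ map w [s + d..<s + d + n]"
    unfolding z_def using \<open>d > 0\<close> upt_add_eq_append[of s "s + d" n]
    by (simp add: add.assoc flip: map_append)
  also have "map w [s + d..<s + d + n] = y"
    unfolding y_def using period by (intro nth_equalityI) (auto simp: add_ac)
  finally have z: "z = x @ y" unfolding x_def .
  have "[s..<s + d] = [s..<s + n] @ [s + n..<s + d]"
    using upt_add_eq_append[of s "s + n" "d - n"] \<open>n \<le> d\<close> by simp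
  then have "x = y @ map w [s + n..<s + d]" unfolding x_def y_def by simp
  then have "Sublist.prefix y x" by simp
  moreover have "x \<noteq> []" "z \<noteq> []" "length x = d" "length z = d + n"
    using \<open>d > 0\<close> z by (auto simp: x_def y_def)
  moreover have "z = concat (replicate 1 x) @ y" using z by simp
  ultimately have "is_power (of_nat (d + n) / of_nat d) z"
    unfolding is_power_def by metis
  moreover have "subword z w" unfolding subword_def subsequence_def z_def by blast
  moreover have "r \<le> of_rat (of_nat (d + n) / of_nat d)"
    using r by (simp add: of_rat_divide of_rat_add)
  ultimately show ?thesis unfolding contains_power_def by blast
qed

text \<open>
  The second hypothesis says that at most two letters occur on the scales above 0. On such a scale
  the letters at \<open>D\<close> and \<open>3 * D\<close> differ, so the letter at \<open>2 * D\<close>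
  repeats one of them; this supplies the centre of a shift-invariant block.
\<close>

lemma contains_powers_below_two:
  assumes alt: "dyadically_alternating w"
    and binary: "\<And>m n. odd m \<Longrightarrow> odd n \<Longrightarrow> w m \<noteq> w n \<Longrightarrow> range (odd_part w) = {w m, w n}"
    and r: "r < 2"
  shows "contains_power r w"
proof -
  have "(\<lambda>e. 2 - (1 / 2) ^ Suc e :: real) \<longlonglongrightarrow> 2 - 0"
    by (intro tendsto_intros LIMSEQ_Suc LIMSEQ_power_zero) auto
  then have "eventually (\<lambda>e. 2 - (1 / 2) ^ Suc e > r) sequentially"
    using r by (intro order_tendstoD) auto
  then obtain e where e: "r < 2 - (1 / 2) ^ Suc e"
    by (auto simp: eventually_sequentially)
  define D :: nat where "D = 2 ^ Suc e"
  have D: "even D" "D > 0" "D = 2 * 2 ^ e" unfolding D_def by simp_all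
  obtain c where c: "c > 0" "w (D * c - 1) = w (D * (c + 1) - 1)"
  proof -
    have "w (D * 3 - 1) \<noteq> w (D * 1 - 1)"
      using dyadically_alternating_neq[OF alt, of 1 1 "Suc e"] by (simp add: D_def)
    then have "range (odd_part w) = {w (D * 3 - 1), w (D * 1 - 1)}"
      using D by (intro binary) auto
    moreover have "w (D * 2 - 1) = odd_part w (D - 1)"
      using D(2) by (auto simp: odd_part_def intro!: arg_cong[of _ _ w])
    ultimately have "w (D * 2 - 1) = w (D * 3 - 1) \<or> w (D * 2 - 1) = w (D * 1 - 1)"
      by (metis insertE rangeI singletonD)
    then show thesis using that[of 1] that[of 2] by (auto simp: numeral_eq_Suc)
  qed
  \<comment> \<open>The first index of the block: the position \<open>s + 1\<close> follows \<open>D * c - 2 ^ e\<close>.\<close>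
  define s where "s = D * c - 2 ^ e"
  have "2 ^ e \<le> D * c" using D c(1) by (cases c) auto
  then have s: "s + 2 ^ e = D * c" unfolding s_def by simp
  have period: "w (s + t + D) = w (s + t)" if "t < D - 1" for t
  proof -
    have "w ((s + t + 1) + 2 ^ Suc e - 1) = w (s + t + 1 - 1)"
      using that s D c(2) by (intro shift_invariant_block[OF alt, of e c]) (auto simp: D_def)
    then show ?thesis by (simp add: D_def)
  qed
  have "real (D + (D - 1)) / real D = 2 - 1 / real D"
    using D(2) by (simp add: field_simps of_nat_diff)
  also have "1 / real D = (1 / 2) ^ Suc e" by (simp add: D_def power_one_over)
  finally have "r \<le> real (D + (D - 1)) / real D" using e by simp
  then show ?thesis
    using contains_powerI_period[of D "D - 1" w s r] D period by fastforce
qed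

section \<open>Paperfolding words\<close>

lemma odd_part_funpow: "(odd_part ^^ k) w n = w (2 ^ k * (n + 1) - 1)"
proof (induction k arbitrary: n)
  case (Suc k)
  have "(odd_part ^^ Suc k) w n = (odd_part ^^ k) w (2 * n + 1)"
    by (simp add: odd_part_def)
  also have "\<dots> = w (2 ^ k * (2 * n + 1 + 1) - 1)" by (rule Suc.IH)
  also have "2 ^ k * (2 * n + 1 + 1) = 2 ^ Suc k * (n + 1)" by (simp add: algebra_simps)
  finally show ?case .
qed simp

lemma paperfolding_dyadically_alternating:
  assumes "paperfolding \<alpha> \<beta> f"
  shows "dyadically_alternating f"
  unfolding dyadically_alternating_def
proof
  fix k
  have "\<alpha> \<noteq> \<beta>" using assms by (simp add: paperfolding_def)
  obtain a where a: "a \<in> {\<alpha>, \<beta>}"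
    "\<And>n. (odd_part ^^ k) f (4 * n) = a"
    "\<And>n. (odd_part ^^ k) f (4 * n + 2) = swap_letter \<alpha> \<beta> a"
    using assms unfolding paperfolding_def by blast
  have "a \<noteq> swap_letter \<alpha> \<beta> a" using a(1) \<open>\<alpha> \<noteq> \<beta>\<close> by (auto simp: swap_letter_def)
  moreover have "f (2 ^ k * (4 * n + 1) - 1) = a" for n
    using a(2)[of n] by (simp only: odd_part_funpow)
  moreover have "f (2 ^ k * (4 * n + 3) - 1) = swap_letter \<alpha> \<beta> a" for n
  proof -
    have "4 * n + 2 + 1 = 4 * n + 3" by simp
    then show ?thesis using a(3)[of n] unfolding odd_part_funpow by metis
  qed
  ultimately show "\<exists>a b. a \<noteq> b \<and>
      (\<forall>n. f (2 ^ k * (4 * n + 1) - 1) = a \<and> f (2 ^ k * (4 * n + 3) - 1) = b)"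
    by blast
qed

theorem theorem11:
  fixes f v :: "nat word"
  assumes "paperfolding 1 4 f"
    and "\<And>n. v (4 * n) = 2"
    and "\<And>n. v (4 * n + 2) = 3"
    and "\<And>n. v (2 * n + 1) = f (2 * n + 1)"
  shows "(\<forall>i j. odd j \<longrightarrow> \<not> contains_square (arith_subseq v i j)) \<and>
         (\<forall>r::real. 0 < r \<and> r < 2 \<longrightarrow> contains_power r v)"
proof -
  have v_odd: "v n = f n" if "odd n" for n
    using that assms(4) by (auto elim: oddE)
  have f_letters: "f n \<in> {1, 4}" for n
    using assms(1) unfolding paperfolding_def by blast
  have v_even: "v n \<in> {2, 3}" if "even n" for n
  proof -
    have "n = 4 * (n div 4) \<or> n = 4 * (n div 4) + 2" using that by presburger
    then show ?thesis using assms(2,3) by (metis insertCI)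
  qed
  have alt: "dyadically_alternating v"
    unfolding dyadically_alternating_def
  proof
    fix k
    show "\<exists>a b. a \<noteq> b \<and>
        (\<forall>n. v (2 ^ k * (4 * n + 1) - 1) = a \<and> v (2 ^ k * (4 * n + 3) - 1) = b)"
    proof (cases k)
      case 0
      then show ?thesis using assms(2,3) by (intro exI[of _ 2] exI[of _ 3]) simp
    next
      case (Suc k')
      have "v (2 ^ k * m - 1) = f (2 ^ k * m - 1)" if "m > 0" for m
        using that Suc by (intro v_odd) simp
      then have "v (2 ^ k * (4 * n + 1) - 1) = f (2 ^ k * (4 * n + 1) - 1)"
        "v (2 ^ k * (4 * n + 3) - 1) = f (2 ^ k * (4 * n + 3) - 1)" for n
        by (metis add_gr_0 zero_less_one, metis add_gr_0 zero_less_numeral)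
      then show ?thesis
        using paperfolding_dyadically_alternating[OF assms(1)]
        unfolding dyadically_alternating_def by presburger
    qed
  qed
  have parity: "v m \<noteq> v n" if "even m" "odd n" for m n
    using v_even[OF that(1)] v_odd[OF that(2)] f_letters[of n] by auto
  have binary: "range (odd_part v) = {v m, v n}" if "odd m" "odd n" "v m \<noteq> v n" for m n
  proof
    have "{v m, v n} = {1, 4}"
      using that f_letters[of m] f_letters[of n] by (auto simp: v_odd)
    moreover have "odd_part v i \<in> {1, 4}" for i
      using f_letters[of "2 * i + 1"] by (simp add: odd_part_def v_odd)
    ultimately show "range (odd_part v) \<subseteq> {v m, v n}" by blast
    show "{v m, v n} \<subseteq> range (odd_part v)"
      using that(1,2) by (auto simp: odd_part_def elim!: oddE)
  qed
  show ?thesis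
    using square_free_arith_subseq[OF alt parity] contains_powers_below_two[OF alt binary] by blast
qed

end
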